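(* Let $q\ge0$, $k$, $r$ be integers with $k\ge 2q+3$ and $2\le r\le k-q-1$. There exists $n_0$ such that for all $n\ge n_0$ the following holds. Let $\mathcal{H}$ be a Berge-$M_{k+1}$-free $r$-uniform hypergraph on $n$ vertices with \[ |E(\mathcal{H})|>h_r(n,k,k-q)=\binom{k+1+q}{r}+(n-k-1-q)\binom{k-q}{r-1}. \] Then there exists a vertex set $S\subseteq V(\mathcal{H})$ with $k-q\le|S|\le k$ such that the hypergraph $\mathcal{H}_0$ is Berge-$M_{k+1-|S|}$-free, where $V(\mathcal{H}_0)=V(\mathcal{H})\setminus S$ and \[ E(\mathcal{H}_0)=\{\,e\setminus S : e\in E(\mathcal{H}),\ |e\cap(V(\mathcal{H})\setminus S)|\ge 2\,\}, \] taken as a multiset (so $\mathcal{H}_0$ need not be uniform and may have parallel edges).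
   Context: $M_k$ denotes the graph matching with $k$ edges. For a graph $F$, a (possibly non-uniform, possibly multi-) hypergraph $\mathcal{B}$ is a Berge-$F$ if there is a bijection $\phi:E(F)\to E(\mathcal{B})$ with $e\subseteq\phi(e)$ for all $e\in E(F)$; a hypergraph is Berge-$F$-free if it contains no subhypergraph that is a Berge-$F$. $h_r(n,k,t)=\binom{2k+1-t}{r}+(n-2k-1+t)\binom{t}{r-1}$. *)

theory Defs
  imports Complex_Main "HOL-Library.Multiset"
begin

text \<open>Graphs are pairs of a vertex set and an edge set.  Hypergraphs are given by a vertex set
  and an edge multiset; a simple hypergraph with edge set \<open>E\<close> has edge multiset \<open>mset_set E\<close>.\<close>

definition uniform_hypergraph :: "nat \<Rightarrow> 'a set \<Rightarrow> 'a set set \<Rightarrow> bool" where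
  "uniform_hypergraph r V E \<longleftrightarrow> finite V \<and> (\<forall>e\<in>E. e \<subseteq> V \<and> card e = r)"

definition matching_graph :: "nat \<Rightarrow> nat set \<times> nat set set" where
  "matching_graph k = ({..<2 * k}, {{2 * i, 2 * i + 1} | i. i < k})"

text \<open>A bijection from a finite edge set \<open>F\<close> onto an edge multiset \<open>B\<close>, parallel edges
  counting as different edges, is a map \<open>\<phi>\<close> under which every edge of \<open>B\<close> is hit exactly as
  often as its multiplicity.\<close>

definition is_berge :: "'a set set \<Rightarrow> 'a set multiset \<Rightarrow> bool" where
  "is_berge F B \<longleftrightarrow> finite F \<and>
     (\<exists>\<phi>. image_mset \<phi> (mset_set F) = B \<and> (\<forall>e\<in>F. e \<subseteq> \<phi> e))"

text \<open>The graph is only given up to isomorphism, so \<open>f\<close> ranges over its copies on vertices of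
  the hypergraph.\<close>

definition berge_free :: "'b set \<times> 'b set set \<Rightarrow> 'a set \<Rightarrow> 'a set multiset \<Rightarrow> bool" where
  "berge_free F V E \<longleftrightarrow>
     \<not> (\<exists>f B. inj_on f (fst F) \<and> f ` fst F \<subseteq> V \<and> B \<subseteq># E \<and>
            is_berge ((\<lambda>e. f ` e) ` snd F) B)"

definition residual_edges :: "'a set \<Rightarrow> 'a set set \<Rightarrow> 'a set \<Rightarrow> 'a set multiset" where
  "residual_edges V E S =
     image_mset (\<lambda>e. e - S) (filter_mset (\<lambda>e. card (e \<inter> (V - S)) \<ge> 2) (mset_set E))"

text \<open>Integer-valued, so that \<open>n - 2k - 1 + t\<close> is not truncated; used for \<open>t \<le> 2k + 1\<close>.\<close>

definition h :: "nat \<Rightarrow> nat \<Rightarrow> nat \<Rightarrow> nat \<Rightarrow> int" where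
  "h r n k t = int ((2 * k + 1 - t) choose r)
     + (int n - 2 * int k - 1 + int t) * int (t choose (r - 1))"

lemma h_minus:
  assumes "q \<le> k"
  shows "h r n k (k - q) = int ((k + 1 + q) choose r)
     + (int n - int k - 1 - int q) * int ((k - q) choose (r - 1))"
proof -
  have "2 * k + 1 - (k - q) = k + 1 + q" using assms by simp
  moreover have "int n - 2 * int k - 1 + int (k - q) = int n - int k - 1 - int q"
    using assms by (simp add: of_nat_diff)
  ultimately show ?thesis by (simp only: h_def)
qed

end

theory Submission
  imports Defs
begin

text \<open>Let \<open>S\<close> be the set of vertices whose degree exceeds a large constant depending only on \<open>k\<close>.
  Any Berge matching of bounded size avoiding \<open>S\<close> extends greedily by one fresh hyperedge and one
  fresh vertex for every element of \<open>S\<close>; hence \<open>card S \<le> k\<close>, and a Berge matching with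
  \<open>k + 1 - card S\<close> edges in the residual hypergraph would give one with \<open>k + 1\<close> edges.
  Conversely, let \<open>U\<close> be the vertex set of a maximum Berge matching. An edge outside that matching
  has at most one vertex outside \<open>U\<close>, so all but boundedly many edges consist of
  \<open>r - 1\<close> vertices of \<open>S\<close> and one further vertex. There are at most
  \<open>n * (card S choose (r - 1))\<close> of those, which is too few if \<open>card S < k - q\<close>.\<close>

section \<open>Berge matchings as indexed core pairs and hyperedges\<close>

text \<open>An explicit form of a Berge copy of a matching with \<open>m\<close> edges: the i-th
  graph edge is the pair of core vertices at indices 2i and 2i+1, carried by the hyperedge
  \<open>g i\<close>. With indices, enlarging a matching is a function update.\<close>

definition berge_matching ::
    "nat \<Rightarrow> (nat \<Rightarrow> 'a) \<Rightarrow> (nat \<Rightarrow> 'a set) \<Rightarrow> 'a set \<Rightarrow> 'a set set \<Rightarrow> bool" where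
  "berge_matching m x g V E \<longleftrightarrow> inj_on x {..<2 * m} \<and> x ` {..<2 * m} \<subseteq> V \<and> inj_on g {..<m} \<and>
     (\<forall>i<m. g i \<in> E \<and> x (2 * i) \<in> g i \<and> x (2 * i + 1) \<in> g i)"

lemma inj_on_consecutive_pairs:
  fixes x :: "nat \<Rightarrow> 'a"
  assumes "inj_on x {..<2 * m}"
  shows "inj_on (\<lambda>i. {x (2 * i), x (2 * i + 1)}) {..<m}"
proof (rule inj_onI)
  fix i j assume ij: "i \<in> {..<m}" "j \<in> {..<m}"
    "{x (2 * i), x (2 * i + 1)} = {x (2 * j), x (2 * j + 1)}"
  then have "x (2 * i) = x (2 * j) \<or> x (2 * i) = x (2 * j + 1)"
    by auto
  moreover have "2 * i \<in> {..<2 * m}" "2 * j \<in> {..<2 * m}" "2 * j + 1 \<in> {..<2 * m}"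
    using ij by auto
  ultimately have "2 * i = 2 * j \<or> 2 * i = 2 * j + 1"
    using assms by (meson inj_onD)
  then show "i = j" by presburger
qed

lemma image_matching_graph_edges:
  "(\<lambda>e. x ` e) ` snd (matching_graph m) = (\<lambda>i. {x (2 * i), x (2 * i + 1)}) ` {..<m}"
proof -
  have "snd (matching_graph m) = (\<lambda>i. {2 * i, 2 * i + 1}) ` {..<m}"
    unfolding matching_graph_def by auto
  then show ?thesis by (simp add: image_image)
qed

lemma berge_matching_not_berge_free:
  assumes "finite E" and M: "berge_matching m x g V E"
  shows "\<not> berge_free (matching_graph m) V (mset_set E)"
proof -
  define p where "p i = {x (2 * i), x (2 * i + 1)}" for i
  \<comment> \<open>Hyperedges are indexed by numbers, while \<open>is_berge\<close> wants a map on
    graph edges; the index is recovered by inverting the injective \<open>p\<close>.\<close>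
  define \<phi> where "\<phi> = g \<circ> the_inv_into {..<m} p"
  have injx: "inj_on x {..<2 * m}" and injg: "inj_on g {..<m}" and gE: "g ` {..<m} \<subseteq> E"
    using M by (auto simp: berge_matching_def)
  have injp: "inj_on p {..<m}"
    unfolding p_def using injx by (rule inj_on_consecutive_pairs)
  have \<phi>: "\<phi> (p i) = g i" if "i < m" for i
    using that injp by (simp add: \<phi>_def the_inv_into_f_f)
  have F: "(\<lambda>e. x ` e) ` snd (matching_graph m) = p ` {..<m}"
    unfolding p_def by (rule image_matching_graph_edges)
  have "inj_on \<phi> (p ` {..<m})"
    using injg \<phi> by (auto simp: inj_on_def)
  then have "image_mset \<phi> (mset_set (p ` {..<m})) = mset_set (\<phi> ` p ` {..<m})"
    by (rule image_mset_mset_set)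
  also have "\<phi> ` p ` {..<m} = g ` {..<m}"
    using \<phi> by (auto simp: image_iff)
  finally have img: "image_mset \<phi> (mset_set (p ` {..<m})) = mset_set (g ` {..<m})" .
  have "is_berge (p ` {..<m}) (mset_set (g ` {..<m}))"
    unfolding is_berge_def using img M \<phi>
    by (intro conjI exI[of _ \<phi>]) (auto simp: p_def berge_matching_def)
  moreover have "mset_set (g ` {..<m}) \<subseteq># mset_set E"
    using gE \<open>finite E\<close> by (simp add: subset_imp_msubset_mset_set)
  moreover have "fst (matching_graph m) = {..<2 * m}"
    by (simp add: matching_graph_def)
  ultimately show ?thesis
    unfolding berge_free_def not_not using F M
    by (intro exI[of _ x] exI[of _ "mset_set (g ` {..<m})"]) (simp add: berge_matching_def)
qed

text \<open>Parallel edges of the residual multiset come from different hyperedges with equal trace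
  outside S. Multiplicity counts such preimages, so choosing one preimage at a time and deleting it
  never runs short and gives distinct hyperedges.\<close>

lemma image_mset_subset_lift:
  assumes "finite F" "finite E"
    and "image_mset \<phi> (mset_set F) \<subseteq># image_mset f (mset_set E)"
  shows "\<exists>\<psi>. inj_on \<psi> F \<and> \<psi> ` F \<subseteq> E \<and> (\<forall>y\<in>F. f (\<psi> y) = \<phi> y)"
  using assms
proof (induction F arbitrary: E rule: finite_induct)
  case empty
  then show ?case by simp
next
  case (insert y F)
  have sub: "add_mset (\<phi> y) (image_mset \<phi> (mset_set F)) \<subseteq># image_mset f (mset_set E)"
    using insert by simp
  then have "\<phi> y \<in># image_mset f (mset_set E)"
    by (meson mset_subset_eq_insertD)
  then obtain e where e: "e \<in> E" "\<phi> y = f e"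
    using insert.prems by auto
  have "mset_set E = add_mset e (mset_set (E - {e}))"
    using e insert.prems by (metis mset_set.remove)
  then have "image_mset \<phi> (mset_set F) \<subseteq># image_mset f (mset_set (E - {e}))"
    using sub e by simp
  then obtain \<psi> where \<psi>: "inj_on \<psi> F" "\<psi> ` F \<subseteq> E - {e}" "\<forall>y\<in>F. f (\<psi> y) = \<phi> y"
    using insert.IH[of "E - {e}"] insert.prems by auto
  let ?\<psi> = "\<psi>(y := e)"
  have "inj_on ?\<psi> (insert y F)"
    using \<psi> insert.hyps by (auto simp: inj_on_def)
  moreover have "?\<psi> ` insert y F \<subseteq> E"
    using \<psi> e by auto
  moreover have "\<forall>z\<in>insert y F. f (?\<psi> z) = \<phi> z"
    using \<psi> e by auto
  ultimately show ?case by blast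
qed

text \<open>Residual edges are lifted back to distinct full hyperedges, which still contain their
  core pairs. The core stays outside \<open>S\<close>, so every vertex of \<open>S\<close> remains
  available for extension.\<close>

lemma not_berge_free_residual:
  assumes "finite E" and "\<not> berge_free (matching_graph m) (V - S) (residual_edges V E S)"
  shows "\<exists>x g. berge_matching m x g (V - S) E"
proof -
  define p where "p x i = {x (2 * i), x (2 * i + 1)}" for x :: "nat \<Rightarrow> 'a" and i
  from assms(2) obtain x B where injx: "inj_on x {..<2 * m}" and xV: "x ` {..<2 * m} \<subseteq> V - S"
    and B: "B \<subseteq># residual_edges V E S" "is_berge ((\<lambda>e. x ` e) ` snd (matching_graph m)) B"
    by (auto simp: berge_free_def matching_graph_def)
  have F: "(\<lambda>e. x ` e) ` snd (matching_graph m) = p x ` {..<m}"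
    unfolding p_def by (rule image_matching_graph_edges)
  obtain \<phi> where \<phi>: "image_mset \<phi> (mset_set (p x ` {..<m})) = B"
    "\<forall>e\<in>p x ` {..<m}. e \<subseteq> \<phi> e"
    using B(2) unfolding F is_berge_def by blast
  define E' where "E' = {e \<in> E. card (e \<inter> (V - S)) \<ge> 2}"
  have "residual_edges V E S = image_mset (\<lambda>e. e - S) (mset_set E')"
    using \<open>finite E\<close> by (simp add: residual_edges_def E'_def filter_mset_mset_set)
  then obtain \<psi> where \<psi>: "inj_on \<psi> (p x ` {..<m})" "\<psi> ` p x ` {..<m} \<subseteq> E'"
    "\<forall>y\<in>p x ` {..<m}. \<psi> y - S = \<phi> y"
    using image_mset_subset_lift[of "p x ` {..<m}" E' \<phi> "\<lambda>e. e - S"] B(1) \<phi>(1) \<open>finite E\<close>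
    by (auto simp: E'_def)
  have injp: "inj_on (p x) {..<m}"
    unfolding p_def using injx by (rule inj_on_consecutive_pairs)
  have "p x i \<subseteq> \<psi> (p x i)" if "i < m" for i
    using that \<phi>(2) \<psi>(3) by blast
  moreover have "\<psi> (p x i) \<in> E" if "i < m" for i
    using that \<psi>(2) by (auto simp: E'_def)
  ultimately have "berge_matching m x (\<psi> \<circ> p x) (V - S) E"
    using injx xV comp_inj_on[OF injp \<psi>(1)]
    by (auto simp: berge_matching_def p_def)
  then show ?thesis by blast
qed

section \<open>Enlarging Berge matchings\<close>

lemma berge_matching_extend:
  assumes M: "berge_matching m x g V E" and e: "e \<in> E" "e \<notin> g ` {..<m}"
    and uv: "u \<in> e" "v \<in> e" "u \<noteq> v" "u \<in> V" "v \<in> V"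
    and new: "u \<notin> x ` {..<2 * m}" "v \<notin> x ` {..<2 * m}"
  shows "berge_matching (Suc m) (x(2 * m := u, 2 * m + 1 := v)) (g(m := e)) V E"
proof -
  let ?x = "x(2 * m := u, 2 * m + 1 := v)" and ?g = "g(m := e)"
  have set1: "{..<2 * Suc m} = insert (2 * m + 1) (insert (2 * m) {..<2 * m})" by auto
  have same: "?x ` {..<2 * m} = x ` {..<2 * m}"
    by (rule image_cong) auto
  have "inj_on ?x {..<2 * m}"
    using M inj_on_cong[of "{..<2 * m}" ?x x] by (auto simp: berge_matching_def)
  then have "inj_on ?x {..<2 * Suc m}"
    unfolding set1 using new uv same by (auto simp: inj_on_insert)
  moreover have "?x ` {..<2 * Suc m} \<subseteq> V"
    unfolding set1 using uv same M by (auto simp: berge_matching_def)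
  moreover have "inj_on ?g {..<Suc m}"
    using M e by (auto simp: berge_matching_def inj_on_def less_Suc_eq)
  moreover have "\<forall>i<Suc m. ?g i \<in> E \<and> ?x (2 * i) \<in> ?g i \<and> ?x (2 * i + 1) \<in> ?g i"
    using M e uv by (auto simp: berge_matching_def less_Suc_eq)
  ultimately show ?thesis
    by (simp add: berge_matching_def)
qed

lemma berge_matching_extend_high_degree:
  assumes M: "berge_matching m x g V E" and "finite E" and EV: "\<Union>E \<subseteq> V"
    and T: "T \<subseteq> V" "finite T" "T \<inter> x ` {..<2 * m} = {}" "m + card T \<le> k + 1"
    and deg: "\<And>u. u \<in> T \<Longrightarrow> card {e \<in> E. u \<in> e} > 2 ^ (3 * k + 1) + k"
  shows "\<exists>x' g'. berge_matching (m + card T) x' g' V E"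
proof -
  \<comment> \<open>The second conjunct keeps the unprocessed vertices of \<open>T\<close> out of
    the core.\<close>
  have "\<exists>x' g'. berge_matching (m + card A) x' g' V E
      \<and> x' ` {..<2 * (m + card A)} \<inter> (T - A) = {}" if "A \<subseteq> T" for A
    using finite_subset[OF that T(2)] that
  proof (induction A rule: finite_induct)
    case empty
    then show ?case using M T(3) by auto
  next
    case (insert u A)
    let ?m = "m + card A"
    obtain x' g' where M': "berge_matching ?m x' g' V E"
      and dis: "x' ` {..<2 * ?m} \<inter> (T - A) = {}"
      using insert by auto
    \<comment> \<open>All of \<open>T\<close> is forbidden, so a partner never consumes a vertex
      still to be processed.\<close>
    define W where "W = x' ` {..<2 * ?m} \<union> T"
    have "card (insert u A) \<le> card T"
      using insert T(2) by (intro card_mono) auto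
    then have mk: "?m \<le> k" using insert T(4) by simp
    have "card W \<le> 2 * ?m + card T"
      unfolding W_def
      by (rule order_trans[OF card_Un_le]) (simp add: order_trans[OF card_image_le])
    \<comment> \<open>At most 2k core vertices and at most k + 1 vertices of
      \<open>T\<close>.\<close>
    then have cW: "card W \<le> 3 * k + 1" using mk T(4) by simp
    have fW: "finite W" using T(2) by (simp add: W_def)
    have "card (Pow W \<union> g' ` {..<?m}) \<le> card (Pow W) + card (g' ` {..<?m})"
      by (rule card_Un_le)
    also have "card (g' ` {..<?m}) \<le> k"
      using mk card_image_le[of "{..<?m}" g'] by simp
    also have "card (Pow W) \<le> 2 ^ (3 * k + 1)"
      using cW fW by (simp add: card_Pow del: power_Suc)
    also have "2 ^ (3 * k + 1) + k < card {e \<in> E. u \<in> e}"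
      using deg insert by simp
    finally have "\<not> {e \<in> E. u \<in> e} \<subseteq> Pow W \<union> g' ` {..<?m}"
      using fW card_mono[of "Pow W \<union> g' ` {..<?m}" "{e \<in> E. u \<in> e}"] by auto
    then obtain e v where ev: "e \<in> E" "u \<in> e" "e \<notin> g' ` {..<?m}" "v \<in> e" "v \<notin> W"
      by auto
    have u: "u \<in> T" "u \<notin> A" using insert by auto
    let ?x = "x'(2 * ?m := u, 2 * ?m + 1 := v)"
    have M'': "berge_matching (Suc ?m) ?x (g'(?m := e)) V E"
      using ev u T(1) EV dis
      by (intro berge_matching_extend[OF M']) (auto simp: W_def)
    have v: "v \<notin> T" using ev by (simp add: W_def)
    have sub: "?x ` {..<2 * Suc ?m} \<subseteq> {u, v} \<union> x' ` {..<2 * ?m}"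
      by (auto simp: less_Suc_eq)
    have "X \<inter> (T - insert u A) = {}" if "X \<subseteq> {u, v} \<union> Y" "Y \<inter> (T - A) = {}" for X Y
      using that v by blast
    from this[OF sub dis] have x: "?x ` {..<2 * Suc ?m} \<inter> (T - insert u A) = {}" .
    have m: "m + card (insert u A) = Suc ?m"
      using insert by simp
    show ?case
      unfolding m by (intro exI conjI) (rule M'', rule x)
  qed
  from this[of T] show ?thesis by blast
qed

section \<open>Counting edges when few vertices have high degree\<close>

text \<open>The four summands bound four classes covering \<open>E\<close>, relative to a Berge
  matching with core \<open>U\<close> whose size cannot be increased: its own hyperedges, edges
  inside \<open>U\<close>, edges meeting \<open>U - S\<close>, and edges formed by r - 1 vertices of
  \<open>S\<close> and one more vertex.\<close>

lemma card_edges_le: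
  assumes H: "uniform_hypergraph r V E"
    and free: "\<And>x g. \<not> berge_matching (k + 1) x g V E"
    and S: "S \<subseteq> V" and deg: "\<And>u. u \<in> V - S \<Longrightarrow> card {e \<in> E. u \<in> e} \<le> D"
  shows "card E \<le> k + 2 ^ (2 * k) + 2 * k * D + card V * (card S choose (r - 1))"
proof -
  have fV: "finite V" and EV: "\<And>e. e \<in> E \<Longrightarrow> e \<subseteq> V" and Er: "\<And>e. e \<in> E \<Longrightarrow> card e = r"
    using H by (auto simp: uniform_hypergraph_def)
  have fE: "finite E"
    using fV EV by (meson Pow_iff finite_Pow_iff finite_subset subsetI)
  have ex0: "\<exists>x g. berge_matching 0 x g V E" by (simp add: berge_matching_def)
  obtain m where m: "m \<le> k" "\<exists>x g. berge_matching m x g V E"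
    "\<not> (\<exists>x g. berge_matching (Suc m) x g V E)"
  proof -
    have "\<exists>j<k + 1. (\<forall>i\<le>j. \<not> \<not> (\<exists>x g. berge_matching i x g V E))
        \<and> \<not> (\<exists>x g. berge_matching (Suc j) x g V E)"
      using ex0 free by (intro ex_least_nat_less) auto
    then show ?thesis using that by (auto simp: less_Suc_eq_le)
  qed
  then obtain x g where M: "berge_matching m x g V E" by blast
  define U where "U = x ` {..<2 * m}"
  have UV: "U \<subseteq> V" and fU: "finite U" using M by (auto simp: berge_matching_def U_def)
  have cU: "card U \<le> 2 * k"
    using card_image_le[of "{..<2 * m}" x] m(1) by (simp add: U_def)
  define N where "N = {R. R \<subseteq> S \<and> card R = r - 1}"
  have fS: "finite S" using S fV finite_subset by blast
  have "E \<subseteq> g ` {..<m} \<union> Pow U \<union> (\<Union>u\<in>U - S. {e \<in> E. u \<in> e}) \<union> (\<lambda>(v, R). insert v R) ` (V \<times> N)"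
  proof
    fix e assume e: "e \<in> E"
    show "e \<in> g ` {..<m} \<union> Pow U \<union> (\<Union>u\<in>U - S. {e \<in> E. u \<in> e})
      \<union> (\<lambda>(v, R). insert v R) ` (V \<times> N)"
    proof (rule ccontr)
      assume not: "\<not> ?thesis"
      then obtain v where v: "v \<in> e" "v \<notin> U" by auto
      have "w \<in> U" if w: "w \<in> e - {v}" for w
      proof (rule ccontr)
        assume "w \<notin> U"
        then have "berge_matching (Suc m) (x(2 * m := w, 2 * m + 1 := v)) (g(m := e)) V E"
          using not v w e EV[OF e] by (intro berge_matching_extend[OF M]) (auto simp: U_def)
        then show False using m(3) by blast
      qed
      \<comment> \<open>Apart from \<open>v\<close> the edge lies in \<open>U\<close>, and it avoids
        \<open>U - S\<close>.\<close>
      then have "e - {v} \<subseteq> S" using not e by auto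
      moreover have "card (e - {v}) = r - 1"
        using Er[OF e] v by simp
      ultimately have "(v, e - {v}) \<in> V \<times> N" using v EV[OF e] by (auto simp: N_def)
      moreover have "e = insert v (e - {v})" using v by auto
      ultimately have "e \<in> (\<lambda>(v, R). insert v R) ` (V \<times> N)"
        by (intro image_eqI[of _ _ "(v, e - {v})"]) simp_all
      then show False using not by blast
    qed
  qed
  moreover have fN: "finite N" using fS by (simp add: N_def)
  ultimately have "card E \<le>
      card (g ` {..<m} \<union> Pow U \<union> (\<Union>u\<in>U - S. {e \<in> E. u \<in> e}) \<union> (\<lambda>(v, R). insert v R) ` (V \<times> N))"
    using fU fE fV by (intro card_mono) auto
  also have "\<dots> \<le> card (g ` {..<m}) + card (Pow U) + card (\<Union>u\<in>U - S. {e \<in> E. u \<in> e})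
      + card ((\<lambda>(v, R). insert v R) ` (V \<times> N))"
    by (intro order_trans[OF card_Un_le] add_mono order_refl)
  also have "\<dots> \<le> k + 2 ^ (2 * k) + 2 * k * D + card V * (card S choose (r - 1))"
  proof (intro add_mono)
    show "card (g ` {..<m}) \<le> k"
      using card_image_le[of "{..<m}" g] m(1) by simp
    show "card (Pow U) \<le> 2 ^ (2 * k)"
      using fU cU by (simp add: card_Pow)
    have "card (\<Union>u\<in>U - S. {e \<in> E. u \<in> e}) \<le> (\<Sum>u\<in>U - S. card {e \<in> E. u \<in> e})"
      using fU by (intro card_UN_le) auto
    also have "\<dots> \<le> card (U - S) * D"
      using sum_bounded_above[of "U - S" "\<lambda>u. card {e \<in> E. u \<in> e}" D] deg UV by auto
    also have "\<dots> \<le> 2 * k * D"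
      using cU card_mono[of U "U - S"] fU by (intro mult_right_mono) auto
    finally show "card (\<Union>u\<in>U - S. {e \<in> E. u \<in> e}) \<le> 2 * k * D" .
    have "card ((\<lambda>(v, R). insert v R) ` (V \<times> N)) \<le> card (V \<times> N)"
      using fV fN by (intro card_image_le) auto
    then show "card ((\<lambda>(v, R). insert v R) ` (V \<times> N)) \<le> card V * (card S choose (r - 1))"
      using fS by (simp add: card_cartesian_product N_def n_subsets)
  qed
  finally show ?thesis .
qed

section \<open>The set of high-degree vertices\<close>

theorem theorem1p7:
  fixes q k r :: nat
  assumes "k \<ge> 2 * q + 3" and "2 \<le> r" and "r \<le> k - q - 1"
  shows "\<exists>n0::nat. \<forall>n\<ge>n0. \<forall>(V :: 'a set) (E :: 'a set set).
           uniform_hypergraph r V E \<longrightarrow> card V = n \<longrightarrow>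
           berge_free (matching_graph (k + 1)) V (mset_set E) \<longrightarrow>
           int (card E) > h r n k (k - q) \<longrightarrow>
           (\<exists>S\<subseteq>V. k - q \<le> card S \<and> card S \<le> k \<and>
              berge_free (matching_graph (k + 1 - card S)) (V - S) (residual_edges V E S))"
proof -
  \<comment> \<open>\<open>D\<close> is the degree threshold of the greedy extension,
    \<open>K\<close> the part of the edge bound independent of n, and \<open>c\<close> the
    coefficient of n in \<open>h\<close>.\<close>
  define D :: nat where "D = 2 ^ (3 * k + 1) + k"
  define K where "K = k + 2 ^ (2 * k) + 2 * k * D"
  define c where "c = (k - q) choose (r - 1)"
  \<comment> \<open>If \<open>S\<close> were too small, the coefficient of n would drop by at least
    1. The bound on \<open>card V\<close> lets this loss outweigh both \<open>K\<close> and the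
    constant \<open>(k + 1 + q) * c\<close> subtracted in \<open>h\<close>.\<close>
  have "\<exists>S\<subseteq>V. k - q \<le> card S \<and> card S \<le> k \<and>
      berge_free (matching_graph (k + 1 - card S)) (V - S) (residual_edges V E S)"
    if n: "card V \<ge> K + (k + 1 + q) * c" and H: "uniform_hypergraph r V E"
      and free: "berge_free (matching_graph (k + 1)) V (mset_set E)"
      and big: "int (card E) > h r (card V) k (k - q)" for V :: "'a set" and E :: "'a set set"
  proof -
    have fV: "finite V" and EV: "\<Union>E \<subseteq> V"
      using H by (auto simp: uniform_hypergraph_def)
    have fE: "finite E"
      using fV EV by (simp add: finite_UnionD finite_subset)
    have nomatch: "\<not> berge_matching (k + 1) x g V E" for x g
      using berge_matching_not_berge_free[OF fE] free by blast
    define S where "S = {u \<in> V. card {e \<in> E. u \<in> e} > D}"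
    have SV: "S \<subseteq> V" and fS: "finite S" using fV by (auto simp: S_def)
    have "card S \<le> k"
    proof (rule ccontr)
      assume "\<not> card S \<le> k"
      then obtain T where T: "T \<subseteq> S" "card T = k + 1"
        using obtain_subset_with_card_n[of "k + 1" S] by auto
      have "\<exists>x' g'. berge_matching (0 + card T) x' g' V E"
        \<comment> \<open>The extension starts from the empty matching, for which \<open>x\<close>
          and \<open>g\<close> are arbitrary.\<close>
        by (rule berge_matching_extend_high_degree[where k = k and x = undefined and g = undefined])
          (use T SV fS fE EV finite_subset in \<open>auto simp: berge_matching_def S_def D_def\<close>)
      then show False using nomatch T by simp
    qed
    moreover have "k - q \<le> card S"
    proof (rule ccontr)
      assume "\<not> k - q \<le> card S"
      then have "card S \<le> k - q - 1" by simp
      then have "card S choose (r - 1) \<le> (k - q - 1) choose (r - 1)"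
        by (rule binomial_right_mono)
      \<comment> \<open>By Pascal's rule the difference is \<open>a choose b\<close>, which is
        positive since b \<le> a.\<close>
      also have "\<dots> < c"
      proof -
        obtain a b where ab: "k - q = Suc a" "r - 1 = Suc b"
          using assms by (cases "k - q"; cases "r - 1") auto
        have "b \<le> a" using ab assms by simp
        then show ?thesis unfolding c_def ab by simp
      qed
      finally have lt: "card S choose (r - 1) < c" .
      then have "card V * (card S choose (r - 1)) \<le> card V * (c - 1)"
        by (intro mult_left_mono) auto
      moreover have "card E \<le> K + card V * (card S choose (r - 1))"
        unfolding K_def
        by (rule card_edges_le[OF H nomatch SV]) (auto simp: S_def)
      moreover have "c > 0" using lt by simp
      then have "card V * (c - 1) + card V = card V * c"
        by (cases c) auto
      ultimately have "card E + (k + 1 + q) * c \<le> card V * c" using n by linarith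
      then have "int (card E + (k + 1 + q) * c) \<le> int (card V * c)"
        by (rule of_nat_mono)
      \<comment> \<open>The first binomial in \<open>h\<close> is nonnegative.\<close>
      moreover have "h r (card V) k (k - q) \<ge> (int (card V) - int k - 1 - int q) * int c"
        using assms by (simp add: h_minus c_def)
      ultimately show False using big by (simp add: algebra_simps)
    qed
    moreover have "berge_free (matching_graph (k + 1 - card S)) (V - S) (residual_edges V E S)"
    proof (rule ccontr)
      assume "\<not> ?thesis"
      then obtain x g where M: "berge_matching (k + 1 - card S) x g (V - S) E"
        using not_berge_free_residual[OF fE] by blast
      then have M': "berge_matching (k + 1 - card S) x g V E"
        by (auto simp: berge_matching_def)
      \<comment> \<open>The core avoids \<open>S\<close>, so one new pair per vertex of
        \<open>S\<close> brings the size to k + 1.\<close>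
      have "\<exists>x' g'. berge_matching (k + 1 - card S + card S) x' g' V E"
        by (rule berge_matching_extend_high_degree[OF M', where k = k])
          (use M SV fS fE EV \<open>card S \<le> k\<close> in \<open>auto simp: berge_matching_def S_def D_def\<close>)
      then show False using nomatch \<open>card S \<le> k\<close> by simp
    qed
    ultimately show ?thesis using SV by blast
  qed
  then show ?thesis
    by (intro exI[of _ "K + (k + 1 + q) * c"]) blast
qed

end
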